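(* Let $d\ge 0$ and $r\ge 1$ be integers and let $\nu=(\nu(1),\ldots,\nu(r))$ be an $r$-tuple of integers. Then \[ \sum_{k=0}^{\infty}(d)_k\sum_{s\in S(\nu,k)}\frac{1}{\prod_{\emptyset\neq U\subseteq[r]} s(U)!}\;=\;\prod_{i=1}^r\binom{d}{\nu(i)}. \]
   Context: $(d)_k=d(d-1)\cdots(d-k+1)$ is the falling factorial, and $\binom{d}{n}=0$ for $n<0$. For an integer $k$, $S(\nu,k)$ is the set of $(2^r-1)$-tuples $s=(s(U))_{\emptyset\ne U\subseteq[r]}$ of nonnegative integers, indexed by the nonempty subsets $U$ of $[r]=\{1,\ldots,r\}$, such that $\nu(i)=\sum_{U\ni i}s(U)$ for each $1\le i\le r$ and $k=\sum_{\emptyset\ne U\subseteq[r]}s(U)$. *)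

theory Defs
  imports Complex_Main "HOL-Library.FuncSet"
begin

definition falling_factorial :: "real \<Rightarrow> nat \<Rightarrow> real" where
  "falling_factorial x k = (\<Prod>i<k. x - real i)"

definition int_choose :: "nat \<Rightarrow> int \<Rightarrow> nat" where
  "int_choose d n = (if n < 0 then 0 else d choose nat n)"

definition nonempty_subsets :: "nat \<Rightarrow> nat set set" where
  "nonempty_subsets r = {U. U \<subseteq> {1..r} \<and> U \<noteq> {}}"

text \<open>Tuples indexed by \<open>nonempty_subsets r\<close> are extensional functions, so that
  distinct elements of the set below are distinct tuples.\<close>

definition S :: "nat \<Rightarrow> (nat \<Rightarrow> int) \<Rightarrow> int \<Rightarrow> (nat set \<Rightarrow> nat) set" where
  "S r \<nu> k = {s \<in> nonempty_subsets r \<rightarrow>\<^sub>E UNIV.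
     (\<forall>i\<in>{1..r}. \<nu> i = (\<Sum>U | U \<in> nonempty_subsets r \<and> i \<in> U. int (s U))) \<and>
     k = (\<Sum>U\<in>nonempty_subsets r. int (s U))}"

lemma finite_nonempty_subsets: "finite (nonempty_subsets r)"
  by (rule finite_subset[of _ "Pow {1..r}"]) (auto simp: nonempty_subsets_def)

text \<open>Sums over \<open>S r \<nu> k\<close> are therefore genuine finite sums.\<close>

lemma finite_S: "finite (S r \<nu> k)"
proof (rule finite_subset)
  show "S r \<nu> k \<subseteq> nonempty_subsets r \<rightarrow>\<^sub>E {..nat k}"
  proof
    fix s assume s: "s \<in> S r \<nu> k"
    have "s U \<le> nat k" if "U \<in> nonempty_subsets r" for U
    proof -
      have "int (s U) \<le> (\<Sum>U\<in>nonempty_subsets r. int (s U))"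
        by (rule member_le_sum) (use that finite_nonempty_subsets in auto)
      with s show ?thesis by (simp add: S_def)
    qed
    with s show "s \<in> nonempty_subsets r \<rightarrow>\<^sub>E {..nat k}"
      by (auto simp: S_def PiE_iff)
  qed
  show "finite (nonempty_subsets r \<rightarrow>\<^sub>E {..nat k})"
    by (simp add: finite_PiE finite_nonempty_subsets)
qed

end

theory Submission
  imports Defs "HOL-Combinatorics.Multiset_Permutations"
begin

text \<open>Both sides count the \<open>r\<close>-tuples \<open>(A\<^sub>1, \<dots>, A\<^sub>r)\<close> of subsets of a \<open>d\<close>-set with
  \<open>|A\<^sub>i| = \<nu>(i)\<close>. Recording for each point \<open>j\<close> the set of all \<open>i\<close> with \<open>j \<in> A\<^sub>i\<close> turns such a
  tuple into a word of length \<open>d\<close> over the subsets of \<open>[r]\<close>. If the letter \<open>U\<close> occurs \<open>s(U)\<close> times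
  for each nonempty \<open>U\<close>, then \<open>s \<in> S(\<nu>, k)\<close>, where \<open>k\<close> is the number of nonempty letters, and
  the number of words with the same \<open>s\<close> is the multinomial coefficient
  \<open>d! / ((d - k)! \<Prod> s(U)!) = (d)\<^sub>k / \<Prod> s(U)!\<close>.\<close>

definition incidence_words :: "nat \<Rightarrow> nat \<Rightarrow> (nat \<Rightarrow> int) \<Rightarrow> nat set list set" where
  "incidence_words d r \<nu> = {xs. set xs \<subseteq> Pow {1..r} \<and> length xs = d \<and>
     (\<forall>i\<in>{1..r}. \<nu> i = int (length (filter (\<lambda>U. i \<in> U) xs)))}"

lemma finite_incidence_words: "finite (incidence_words d r \<nu>)"
  by (rule finite_subset[OF _ finite_lists_length_eq[of "Pow {1..r}" d]])
    (auto simp: incidence_words_def)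

text \<open>Stating the size as an integer covers negative entries of \<open>\<nu>\<close>: no set
  has negative size, which matches the value 0 of \<open>int_choose\<close>.\<close>

lemma card_subsets_int_card:
  assumes "finite A"
  shows "card {B. B \<subseteq> A \<and> int (card B) = n} = int_choose (card A) n"
proof (cases "n < 0")
  case False
  then have "{B. B \<subseteq> A \<and> int (card B) = n} = {B. B \<subseteq> A \<and> card B = nat n}"
    by auto
  with False assms show ?thesis by (simp add: n_subsets int_choose_def)
qed (auto simp: int_choose_def)

text \<open>Word and tuple are the two readings of one 0-1 incidence matrix, by points and by
  indices. Read by indices, the \<open>r\<close> subsets are chosen independently, hence the
  product.\<close>

lemma card_incidence_words:
  "card (incidence_words d r \<nu>) = (\<Prod>i=1..r. int_choose d (\<nu> i))"
proof -
  let ?B = "\<Pi>\<^sub>E i\<in>{1..r}. {A. A \<subseteq> {..<d} \<and> int (card A) = \<nu> i}"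
  let ?f = "\<lambda>xs. \<lambda>i\<in>{1..r}. {j. j < d \<and> i \<in> xs ! j}"
  let ?g = "\<lambda>A. map (\<lambda>j. {i\<in>{1..r}. j \<in> A i}) [0..<d]"
  have "bij_betw ?f (incidence_words d r \<nu>) ?B"
  proof (rule bij_betw_byWitness[where f' = ?g])
    show "\<forall>xs\<in>incidence_words d r \<nu>. ?g (?f xs) = xs"
    proof
      fix xs assume xs: "xs \<in> incidence_words d r \<nu>"
      show "?g (?f xs) = xs"
      proof (rule nth_equalityI)
        fix j assume "j < length (?g (?f xs))"
        then have j: "j < d" by simp
        \<comment> \<open>\<open>?g\<close> only collects indices from \<open>{1..r}\<close>, so it
          recovers a letter only if that letter lies within \<open>{1..r}\<close>.\<close>
        with xs have "xs ! j \<in> set xs" "set xs \<subseteq> Pow {1..r}"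
          by (auto simp: incidence_words_def)
        then have "xs ! j \<subseteq> {1..r}" by blast
        with j show "?g (?f xs) ! j = xs ! j" by auto
      qed (use xs in \<open>simp add: incidence_words_def\<close>)
    qed
    show "\<forall>A\<in>?B. ?f (?g A) = A"
    proof
      fix A assume A: "A \<in> ?B"
      show "?f (?g A) = A"
      proof
        fix i
        show "?f (?g A) i = A i"
        proof (cases "i \<in> {1..r}")
          case True
          with A have "A i \<subseteq> {..<d}" by (auto simp: PiE_iff)
          with True show ?thesis by auto
        next
          case False
          \<comment> \<open>Outside \<open>{1..r}\<close> both sides are
            \<open>undefined\<close>.\<close>
          then show ?thesis by (simp add: PiE_arb[OF A False] del: atLeastAtMost_iff)
        qed
      qed
    qed
    show "?f ` incidence_words d r \<nu> \<subseteq> ?B"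
      by (auto simp: incidence_words_def length_filter_conv_card)
    show "?g ` ?B \<subseteq> incidence_words d r \<nu>"
    proof
      fix xs assume "xs \<in> ?g ` ?B"
      then obtain A where A: "A \<in> ?B" and xs: "xs = ?g A" by blast
      have "\<nu> i = int (length (filter (\<lambda>U. i \<in> U) xs))" if i: "i \<in> {1..r}" for i
      proof -
        have "A i \<subseteq> {..<d}" "int (card (A i)) = \<nu> i" using A i by (auto simp: PiE_iff)
        moreover have "{j. j < length xs \<and> i \<in> xs ! j} = {j. j < d \<and> j \<in> A i}"
          using i by (auto simp: xs)
        moreover have "{j. j < d \<and> j \<in> A i} = A i" using \<open>A i \<subseteq> {..<d}\<close> by auto
        ultimately show ?thesis by (simp add: length_filter_conv_card)
      qed
      then show "xs \<in> incidence_words d r \<nu>"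
        by (auto simp: incidence_words_def xs)
    qed
  qed
  then have "card (incidence_words d r \<nu>) = card ?B"
    by (rule bij_betw_same_card)
  also have "\<dots> = (\<Prod>i=1..r. int_choose d (\<nu> i))"
    by (simp add: card_PiE card_subsets_int_card)
  finally show ?thesis .
qed

text \<open>Groups positions by their letter. A constantly true \<open>P\<close> gives the length of
  the word, and \<open>P\<close> testing for \<open>i\<close> gives the size of the
  \<open>i\<close>-th subset.\<close>

lemma length_filter_eq_sum_count:
  assumes "finite A" "set xs \<subseteq> A"
  shows "length (filter P xs) = (\<Sum>x | x \<in> A \<and> P x. count (mset xs) x)"
  using assms(2)
proof (induction xs)
  case (Cons y ys)
  have "(\<Sum>x | x \<in> A \<and> P x. count (mset (y # ys)) x) =
        (\<Sum>x | x \<in> A \<and> P x. (if x = y then 1 else 0) + count (mset ys) x)"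
    by (rule sum.cong) auto
  also have "\<dots> = (if P y then 1 else 0) + (\<Sum>x | x \<in> A \<and> P x. count (mset ys) x)"
    using Cons.prems assms(1) by (simp add: sum.distrib)
  finally show ?case using Cons by simp
qed simp

lemma Pow_eq_insert_nonempty_subsets: "Pow {1..r} = insert {} (nonempty_subsets r)"
  by (auto simp: nonempty_subsets_def)

lemma empty_notin_nonempty_subsets: "{} \<notin> nonempty_subsets r"
  by (simp add: nonempty_subsets_def)

text \<open>The tuple \<open>s\<close> of a word, restricted so that it can equal an element of
  \<open>S\<close> as a function. The count of the letter \<open>{}\<close> is left out; the length
  of the word determines it.\<close>

definition letter_counts :: "nat \<Rightarrow> nat set list \<Rightarrow> nat set \<Rightarrow> nat" where
  "letter_counts r xs = (\<lambda>U\<in>nonempty_subsets r. count (mset xs) U)"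

text \<open>No \<open>i\<close> lies in the letter \<open>{}\<close>, so dropping its count leaves
  the sum unchanged.\<close>

lemma length_filter_eq_sum_letter_counts:
  assumes "set xs \<subseteq> Pow {1..r}"
  shows "length (filter (\<lambda>U. i \<in> U) xs) =
         (\<Sum>U | U \<in> nonempty_subsets r \<and> i \<in> U. letter_counts r xs U)"
proof -
  have "length (filter (\<lambda>U. i \<in> U) xs) = (\<Sum>U | U \<in> Pow {1..r} \<and> i \<in> U. count (mset xs) U)"
    by (rule length_filter_eq_sum_count) (use assms in auto)
  also have "\<dots> = (\<Sum>U | U \<in> nonempty_subsets r \<and> i \<in> U. letter_counts r xs U)"
    by (rule sum.cong) (auto simp: nonempty_subsets_def letter_counts_def)
  finally show ?thesis .
qed

lemma length_eq_count_empty_plus: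
  assumes "set xs \<subseteq> Pow {1..r}"
  shows "length xs = count (mset xs) {} + (\<Sum>U\<in>nonempty_subsets r. letter_counts r xs U)"
proof -
  have "length xs = (\<Sum>U\<in>Pow {1..r}. count (mset xs) U)"
    using length_filter_eq_sum_count[of "Pow {1..r}" xs "\<lambda>_. True"] assms
    by (simp add: Pow_def)
  also have "\<dots> = count (mset xs) {} + (\<Sum>U\<in>nonempty_subsets r. count (mset xs) U)"
    unfolding Pow_eq_insert_nonempty_subsets
    by (rule sum.insert[OF finite_nonempty_subsets empty_notin_nonempty_subsets])
  finally show ?thesis by (simp add: letter_counts_def)
qed

lemma letter_counts_in_S:
  assumes "xs \<in> incidence_words d r \<nu>"
  shows "\<exists>k\<le>d. letter_counts r xs \<in> S r \<nu> (int k)"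
proof (intro exI conjI)
  \<comment> \<open>The number of nonempty letters, hence at most the length
    \<open>d\<close>.\<close>
  let ?k = "\<Sum>U\<in>nonempty_subsets r. letter_counts r xs U"
  have sub: "set xs \<subseteq> Pow {1..r}" and len: "length xs = d"
    using assms by (auto simp: incidence_words_def)
  show "?k \<le> d" using length_eq_count_empty_plus[OF sub] len by simp
  have "\<nu> i = int (\<Sum>U | U \<in> nonempty_subsets r \<and> i \<in> U. letter_counts r xs U)"
    if "i \<in> {1..r}" for i
    using assms that unfolding incidence_words_def
    by (simp add: length_filter_eq_sum_letter_counts[symmetric])
  then show "letter_counts r xs \<in> S r \<nu> (int ?k)"
    by (auto simp: S_def letter_counts_def)
qed

lemma falling_factorial_eq_fact_div:
  assumes "k \<le> d"
  shows "falling_factorial (real d) k = fact d / fact (d - k)"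
  using assms
proof (induction k)
  case (Suc k)
  \<comment> \<open>As \<open>d - k\<close> is positive, it splits off from
    \<open>fact (d - k)\<close> and cancels against the new factor of the falling factorial.\<close>
  then have "d - k = Suc (d - Suc k)" by simp
  then have "(fact (d - k) :: real) = real (d - k) * fact (d - Suc k)"
    by (metis fact_Suc)
  moreover have "real (d - k) = real d - real k" "real d - real k \<noteq> 0" using Suc.prems by auto
  ultimately show ?case using Suc by (simp add: falling_factorial_def)
qed (simp add: falling_factorial_def)

lemma falling_factorial_eq_0:
  assumes "d < k"
  shows "falling_factorial (real d) k = 0"
  using assms by (auto simp: falling_factorial_def)

text \<open>Fixing \<open>s\<close> fixes the whole multiset of letters, so these words are the
  arrangements of one multiset and a multinomial coefficient counts them.\<close>

lemma card_words_with_letter_counts: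
  assumes s: "s \<in> S r \<nu> (int k)" and "k \<le> d"
  shows "real (card {xs \<in> incidence_words d r \<nu>. letter_counts r xs = s}) =
         falling_factorial (real d) k * (1 / (\<Prod>U\<in>nonempty_subsets r. fact (s U)))"
proof -
  note fin = finite_nonempty_subsets[of r] and ne = empty_notin_nonempty_subsets[of r]
  \<comment> \<open>The common multiset of letters: \<open>s U\<close> copies of each nonempty
    \<open>U\<close>, padded with \<open>{}\<close> to size \<open>d\<close>.\<close>
  define M where "M = replicate_mset (d - k) {} + (\<Sum>U\<in>nonempty_subsets r. replicate_mset (s U) U)"
  have count_M: "count M V = (if V = {} then d - k else 0) + (if V \<in> nonempty_subsets r then s V else 0)" for V
  proof -
    have "count (\<Sum>U\<in>nonempty_subsets r. replicate_mset (s U) U) V =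
          (\<Sum>U\<in>nonempty_subsets r. if U = V then s U else 0)"
      unfolding count_sum by (rule sum.cong) auto
    then show ?thesis using fin by (simp add: M_def)
  qed
  have count_empty: "count M {} = d - k" using ne by (simp add: count_M)
  have count_nonempty: "count M U = s U" if "U \<in> nonempty_subsets r" for U
    using that ne by (auto simp: count_M)
  have set_M: "set_mset M \<subseteq> Pow {1..r}"
  proof
    fix V assume "V \<in># M"
    then have "count M V \<noteq> 0" by simp
    then show "V \<in> Pow {1..r}"
      unfolding count_M Pow_eq_insert_nonempty_subsets by (auto split: if_splits)
  qed
  have "int k = int (\<Sum>U\<in>nonempty_subsets r. s U)" using s by (simp add: S_def)
  then have k: "k = (\<Sum>U\<in>nonempty_subsets r. s U)" by linarith
  have size_M: "size M = d"
    using \<open>k \<le> d\<close> k by (simp add: M_def size_multiset_sum)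
  have "{xs \<in> incidence_words d r \<nu>. letter_counts r xs = s} = permutations_of_multiset M"
  proof (intro set_eqI iffI)
    fix xs assume "xs \<in> {xs \<in> incidence_words d r \<nu>. letter_counts r xs = s}"
    then have sub: "set xs \<subseteq> Pow {1..r}" and len: "length xs = d" and lc: "letter_counts r xs = s"
      by (auto simp: incidence_words_def)
    have "count (mset xs) V = count M V" for V
    proof (cases "V \<in> Pow {1..r}")
      case True
      then consider "V = {}" | "V \<in> nonempty_subsets r"
        unfolding Pow_eq_insert_nonempty_subsets by blast
      then show ?thesis
      proof cases
        case 1
        then show ?thesis
          \<comment> \<open>The nonempty letters fill \<open>k\<close> of the \<open>d\<close>
            positions, which leaves \<open>d - k\<close> for \<open>{}\<close>.\<close>
          using length_eq_count_empty_plus[OF sub] len lc k by (simp add: count_empty)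
      next
        case 2
        then show ?thesis using lc by (auto simp: count_nonempty letter_counts_def)
      qed
    next
      case False
      then have "V \<notin># mset xs" "V \<notin># M" using sub set_M by auto
      then show ?thesis by (simp add: not_in_iff)
    qed
    then show "xs \<in> permutations_of_multiset M"
      by (simp add: permutations_of_multiset_def multiset_eq_iff)
  next
    fix xs assume "xs \<in> permutations_of_multiset M"
    then have xs: "mset xs = M" by (simp add: permutations_of_multiset_def)
    have sub: "set xs \<subseteq> Pow {1..r}" using set_M xs by (metis set_mset_mset)
    have len: "length xs = d" using size_M xs by (metis size_mset)
    have lc: "letter_counts r xs = s"
    proof
      fix U
      show "letter_counts r xs U = s U"
        \<comment> \<open>Off the nonempty subsets both functions are \<open>undefined\<close>,
          since \<open>s\<close> is extensional.\<close>
        using s by (auto simp: letter_counts_def xs count_nonempty S_def PiE_iff extensional_def)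
    qed
    have "\<nu> i = int (length (filter (\<lambda>U. i \<in> U) xs))" if "i \<in> {1..r}" for i
      using s that unfolding length_filter_eq_sum_letter_counts[OF sub] lc by (simp add: S_def)
    with sub len lc show "xs \<in> {xs \<in> incidence_words d r \<nu>. letter_counts r xs = s}"
      by (simp add: incidence_words_def)
  qed
  then have "real (card {xs \<in> incidence_words d r \<nu>. letter_counts r xs = s}) =
             real (fact (size M) div (\<Prod>U\<in>set_mset M. fact (count M U)))"
    by (simp add: card_permutations_of_multiset)
  also have "\<dots> = fact d / (\<Prod>U\<in>set_mset M. fact (count M U))"
    \<comment> \<open>The product of factorials divides \<open>fact (size M)\<close>, so the
      \<open>div\<close> is exact and becomes real division.\<close>
    using card_permutations_of_multiset(2)[of M] by (simp add: real_of_nat_div size_M)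
  \<comment> \<open>Letters that do not occur contribute \<open>fact 0 = 1\<close>.\<close>
  also have "(\<Prod>U\<in>set_mset M. fact (count M U)) = (\<Prod>U\<in>Pow {1..r}. fact (count M U) :: real)"
    by (rule prod.mono_neutral_left) (use set_M in \<open>auto simp: not_in_iff\<close>)
  also have "\<dots> = fact (d - k) * (\<Prod>U\<in>nonempty_subsets r. fact (s U))"
    unfolding Pow_eq_insert_nonempty_subsets prod.insert[OF fin ne] count_empty
    by (simp add: count_nonempty)
  finally show ?thesis
    using \<open>k \<le> d\<close> by (simp add: falling_factorial_eq_fact_div)
qed

text \<open>A tuple determines \<open>k\<close> as the sum of its entries.\<close>

lemma S_disjoint: "k \<noteq> l \<Longrightarrow> S r \<nu> k \<inter> S r \<nu> l = {}"
  by (auto simp: S_def)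

theorem theorem5:
  fixes d r :: nat and \<nu> :: "nat \<Rightarrow> int"
  assumes "r \<ge> 1"
  shows "(\<lambda>k. falling_factorial (real d) k *
            (\<Sum>s\<in>S r \<nu> (int k). 1 / (\<Prod>U\<in>nonempty_subsets r. fact (s U))))
         sums (\<Prod>i=1..r. real (int_choose d (\<nu> i)))"
    (is "?t sums ?R")
proof -
  let ?fibre = "\<lambda>s. {xs \<in> incidence_words d r \<nu>. letter_counts r xs = s}"
  have "?R = real (card (incidence_words d r \<nu>))"
    by (simp add: card_incidence_words)
  also have "card (incidence_words d r \<nu>) = (\<Sum>s\<in>(\<Union>k\<le>d. S r \<nu> (int k)). card (?fibre s))"
  proof -
    have "letter_counts r ` incidence_words d r \<nu> \<subseteq> (\<Union>k\<le>d. S r \<nu> (int k))"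
      using letter_counts_in_S by blast
    \<comment> \<open>Counts the words fibre by fibre over their letter counts.\<close>
    from sum.group[OF finite_incidence_words _ this, of "\<lambda>_. 1 :: nat"] show ?thesis
      by (simp add: finite_S)
  qed
  also have "\<dots> = (\<Sum>k\<le>d. \<Sum>s\<in>S r \<nu> (int k). card (?fibre s))"
    by (rule sum.UNION_disjoint) (auto simp: finite_S S_disjoint)
  also have "real \<dots> = (\<Sum>k\<le>d. ?t k)"
    by (simp add: card_words_with_letter_counts sum_distrib_left)
  finally have "?R = (\<Sum>k\<le>d. ?t k)" .
  moreover have "?t sums (\<Sum>k\<le>d. ?t k)"
    \<comment> \<open>For \<open>k > d\<close> the falling factorial contains the factor
      \<open>d - d\<close>, so the series stops at \<open>d\<close>.\<close>
    by (rule sums_finite) (auto simp: falling_factorial_eq_0)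
  ultimately show ?thesis by simp
qed

end
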